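(* Let $\lambda_{\max}\in(0,\infty]$ and let $\psi:[0,\lambda_{\max})\to\mathbb{R}$ be super-Gaussian. Let $(X_t)_{t\ge 1}$ be random vectors in $\mathbb{R}^d$ with constant conditional mean $\mathbb{E}[X_t\mid\mathcal{F}_{t-1}]=\mu$ for all $t\ge 1$, and suppose $(X_t)$ is $(\Sigma_t)$-sub-$\psi$. Let $(\lambda_t)_{t\ge1}$ be a predictable sequence with values in $(0,\lambda_{\max})$. Fix $0<\epsilon<1$ and $\alpha\in(0,1)$. Then, with probability at least $1-\alpha$, for all $t\geq 1$ simultaneously, $$\left\|\frac{\sum_{i\leq t} \lambda_i X_i}{\sum_{i\leq t}\lambda_i } - \mu\right\| \leq \frac{\sum_{i\leq t}\psi(\lambda_i) \|\Sigma_i\| + d\log(1/\epsilon) + \log(1/\alpha)}{ (1-\epsilon)\sum_{i\le t}\lambda_i}.$$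
   Context: $\mathcal{F}_t=\sigma(X_1,\dots,X_t)$ ($\mathcal{F}_0$ trivial); $(\lambda_t)$ is predictable if $\lambda_t$ is $\mathcal{F}_{t-1}$-measurable for every $t$. $\|\cdot\|$ is the Euclidean norm for vectors and the operator norm for matrices; $\mathbb{S}^{d-1}=\{x\in\mathbb{R}^d:\|x\|=1\}$. $(X_t)$ is $(\Sigma_t)$-sub-$\psi$ if, for every $t$, $\Sigma_t$ is an $\mathcal{F}_t$-measurable random positive semidefinite $d\times d$ matrix and $$\mathbb{E}\big[\exp\{\lambda\langle v,X_t-\mu\rangle-\psi(\lambda)\langle v,\Sigma_tv\rangle\}\mid\mathcal{F}_{t-1}\big]\le 1\quad\text{for all }v\in\mathbb{S}^{d-1},\ \lambda\in[0,\lambda_{\max}).$$ The paper calls $\psi$ CGF-like if it is twice differentiable and $\psi(0)=\lim_{x\to0^+}\psi'(x)=0$, and focuses on CGF-like $\psi$. $\psi$ is super-Gaussian if $\lambda\mapsto\psi(\lambda)/\lambda^2$ is nondecreasing. *)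

theory Defs
  imports "HOL-Probability.Probability"
begin

(* The natural filtration sigma(X 1, ..., X t); the index starts at 1, so t = 0 gives the
   trivial sigma-algebra on space M. *)
definition nat_filt ::
    "'w measure \<Rightarrow> (nat \<Rightarrow> 'w \<Rightarrow> 'b::topological_space) \<Rightarrow> nat \<Rightarrow> 'w measure" where
  "nat_filt M X t =
     sigma (space M) {X i -` A \<inter> space M | i A. i \<in> {1..t} \<and> A \<in> sets borel}"

definition predictable ::
    "(nat \<Rightarrow> 'w measure) \<Rightarrow> (nat \<Rightarrow> 'w \<Rightarrow> 'b::topological_space) \<Rightarrow> bool" where
  "predictable F l \<longleftrightarrow> (\<forall>t\<ge>1. l t \<in> borel_measurable (F (t - 1)))"

(* The library's conditional expectation is real-valued, so a vector-valued one is taken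
   coordinatewise. Without integrability, real_cond_exp would not be meaningful. *)
definition has_const_cond_mean ::
    "'w measure \<Rightarrow> (nat \<Rightarrow> 'w measure) \<Rightarrow> (nat \<Rightarrow> 'w \<Rightarrow> real ^ 'n) \<Rightarrow> real ^ 'n \<Rightarrow> bool" where
  "has_const_cond_mean M F X \<mu> \<longleftrightarrow>
     (\<forall>t\<ge>1. integrable M (X t) \<and>
        (\<forall>k. AE w in M. real_cond_exp M (F (t - 1)) (\<lambda>w. X t w $ k) w = \<mu> $ k))"

definition pos_semidef :: "real ^ 'n ^ 'n \<Rightarrow> bool" where
  "pos_semidef A \<longleftrightarrow> transpose A = A \<and> (\<forall>v. 0 \<le> v \<bullet> (A *v v))"

(* The norm of the type real ^ 'n ^ 'n is the Frobenius norm, not the operator norm. *)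
definition op_norm :: "real ^ 'n ^ 'n \<Rightarrow> real" where
  "op_norm A = onorm ((*v) A)"

(* The integrand is nonnegative but not assumed integrable, hence nn_cond_exp: real_cond_exp
   would return 0 where the conditional expectation is infinite.
   psi is a total function of which only the values on [0, lmax) are used. *)
definition sub_psi ::
    "'w measure \<Rightarrow> (nat \<Rightarrow> 'w measure) \<Rightarrow> ereal \<Rightarrow> (real \<Rightarrow> real) \<Rightarrow> real ^ 'n \<Rightarrow>
     (nat \<Rightarrow> 'w \<Rightarrow> real ^ 'n ^ 'n) \<Rightarrow> (nat \<Rightarrow> 'w \<Rightarrow> real ^ 'n) \<Rightarrow> bool" where
  "sub_psi M F lmax \<psi> \<mu> V X \<longleftrightarrow>
     (\<forall>t\<ge>1. V t \<in> borel_measurable (F t) \<and>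
        (\<forall>w\<in>space M. pos_semidef (V t w)) \<and>
        (\<forall>v\<in>sphere 0 1. \<forall>l. 0 \<le> l \<and> ereal l < lmax \<longrightarrow>
           (AE w in M. nn_cond_exp M (F (t - 1))
              (\<lambda>w. ennreal (exp (l * (v \<bullet> (X t w - \<mu>)) - \<psi> l * (v \<bullet> (V t w *v v))))) w \<le> 1)))"

(* The quotient is undefined at 0, where HOL's division would give 0, so 0 is left out. *)
definition super_gaussian :: "ereal \<Rightarrow> (real \<Rightarrow> real) \<Rightarrow> bool" where
  "super_gaussian lmax \<psi> \<longleftrightarrow> mono_on {l. 0 < l \<and> ereal l < lmax} (\<lambda>l. \<psi> l / l\<^sup>2)"

end

theory Submission
  imports Defs
begin

text \<open>
  Let \<open>S t\<close> be the weighted sum of the \<open>X i - \<mu>\<close> and \<open>C t\<close> that of the operator norms, with weights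
  \<open>l i\<close> and \<open>\<psi> (l i)\<close>. Since \<open>\<psi> (r * l) \<le> r\<^sup>2 * \<psi> l\<close> for \<open>0 < r \<le> 1\<close>, the process
  \<open>exp (u \<bullet> S t - C t)\<close> is a supermartingale for every \<open>u\<close> in the unit ball, not only on the sphere, and
  so is its integral over that ball. At time \<open>t\<close> the integral is at least its part over the ball of radius
  \<open>\<epsilon>\<close> around \<open>(1 - \<epsilon>) *\<^sub>R sgn (S t)\<close>; reflection in the centre and \<open>2 \<le> exp a + exp (- a)\<close> bound
  this below by the volume, a fraction \<open>\<epsilon> ^ d\<close> of the unit ball's, times the value at the centre,
  \<open>exp ((1 - \<epsilon>) * norm (S t) - C t)\<close>. Ville's inequality gives the claim.
  If \<open>\<psi>\<close> takes a negative value, the constant mean forces all \<open>V t\<close> to vanish almost surely.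
\<close>

section \<open>Ville's inequality for nonnegative supermartingales\<close>

text \<open>Paths that have reached level \<open>c\<close> are frozen at the value \<open>c\<close>,
  the others keep running, and the mean of this stopped process does not grow. \<open>step\<close>
  is the supermartingale property in weak form, tested against every nonnegative
  \<open>F t\<close>-measurable weight \<open>Z\<close>.\<close>

lemma ville_finite_horizon:
  fixes N :: "nat \<Rightarrow> 'w \<Rightarrow> ennreal"
  assumes sub: "\<And>t. subalgebra M (F t)"
    and mono: "\<And>s t. s \<le> t \<Longrightarrow> sets (F s) \<subseteq> sets (F t)"
    and adapted: "\<And>t. N t \<in> borel_measurable (F t)"
    and step: "\<And>t Z. Z \<in> borel_measurable (F t) \<Longrightarrow>
      (\<integral>\<^sup>+w. Z w * N (Suc t) w \<partial>M) \<le> (\<integral>\<^sup>+w. Z w * N t w \<partial>M)"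
  shows "c * emeasure M {w \<in> space M. \<exists>j\<le>n. c \<le> N j w} \<le> (\<integral>\<^sup>+w. N 0 w \<partial>M)"
proof -
  define B where "B n = {w \<in> space M. \<exists>j\<le>n. c \<le> N j w}" for n
  have space_F: "space (F t) = space M" for t
    using sub by (auto simp: subalgebra_def)
  have N_le: "N j \<in> borel_measurable (F n)" if "j \<le> n" for j n
    using measurable_mono[of borel borel "F j" "F n"] mono[OF that] adapted[of j]
    by (auto simp: space_F)
  have B_F: "B n \<in> sets (F n)" for n
  proof -
    have "{w \<in> space (F n). c \<le> N j w} \<in> sets (F n)" if "j \<le> n" for j
      using N_le[OF that] by measurable
    moreover have "B n = (\<Union>j\<in>{..n}. {w \<in> space (F n). c \<le> N j w})"
      by (auto simp: B_def space_F)
    ultimately show ?thesis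
      by auto
  qed
  then have B_M [measurable]: "B n \<in> sets M" for n
    using sub by (auto simp: subalgebra_def)
  have N_M [measurable]: "N t \<in> borel_measurable M" for t
    using measurable_from_subalg[OF sub adapted] .
  \<comment> \<open>The integral over the paths still below \<open>c\<close> is carried along;
    without it the induction would not close.\<close>
  have "(\<integral>\<^sup>+w. indicator (- B n) w * N n w \<partial>M) + c * emeasure M (B n) \<le> (\<integral>\<^sup>+w. N 0 w \<partial>M)" for n
  proof (induction n)
    case 0
    have "(\<integral>\<^sup>+w. indicator (- B 0) w * N 0 w \<partial>M) + c * emeasure M (B 0)
        = (\<integral>\<^sup>+w. indicator (- B 0) w * N 0 w + c * indicator (B 0) w \<partial>M)"
      by (subst nn_integral_add) (auto simp: nn_integral_cmult)
    also have "\<dots> \<le> (\<integral>\<^sup>+w. N 0 w \<partial>M)"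
      by (intro nn_integral_mono) (auto simp: B_def split: split_indicator)
    finally show ?case .
  next
    case (Suc n)
    have incr: "B n \<subseteq> B (Suc n)"
      by (auto simp: B_def intro: le_SucI)
    have "(\<integral>\<^sup>+w. indicator (- B (Suc n)) w * N (Suc n) w \<partial>M) + c * emeasure M (B (Suc n) - B n)
        = (\<integral>\<^sup>+w. indicator (- B (Suc n)) w * N (Suc n) w + c * indicator (B (Suc n) - B n) w \<partial>M)"
      by (subst nn_integral_add) (auto simp: nn_integral_cmult)
    \<comment> \<open>A path that first crosses at time \<open>Suc n\<close> has
      \<open>c \<le> N (Suc n) w\<close>; one that has not crossed contributes
      \<open>N (Suc n) w\<close> itself.\<close>
    also have "\<dots> \<le> (\<integral>\<^sup>+w. indicator (space M - B n) w * N (Suc n) w \<partial>M)"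
      using incr by (intro nn_integral_mono) (auto simp: B_def le_Suc_eq split: split_indicator)
    \<comment> \<open>Absence of a crossing up to time \<open>n\<close> is an event of
      \<open>F n\<close>, so its indicator is an admissible \<open>Z\<close>.\<close>
    also have "\<dots> \<le> (\<integral>\<^sup>+w. indicator (space M - B n) w * N n w \<partial>M)"
      using B_F[of n] sets.compl_sets[OF B_F[of n]]
      by (intro step) (auto simp: space_F)
    also have "\<dots> = (\<integral>\<^sup>+w. indicator (- B n) w * N n w \<partial>M)"
      by (intro nn_integral_cong) (auto split: split_indicator)
    finally have *: "(\<integral>\<^sup>+w. indicator (- B (Suc n)) w * N (Suc n) w \<partial>M)
        + c * emeasure M (B (Suc n) - B n) \<le> (\<integral>\<^sup>+w. indicator (- B n) w * N n w \<partial>M)" .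
    have "emeasure M (B (Suc n)) = emeasure M (B (Suc n) - B n) + emeasure M (B n)"
      using incr by (subst plus_emeasure) (auto simp: Un_absorb1 Un_commute)
    then have "(\<integral>\<^sup>+w. indicator (- B (Suc n)) w * N (Suc n) w \<partial>M) + c * emeasure M (B (Suc n))
      = ((\<integral>\<^sup>+w. indicator (- B (Suc n)) w * N (Suc n) w \<partial>M)
        + c * emeasure M (B (Suc n) - B n)) + c * emeasure M (B n)"
      by (simp add: distrib_left add.assoc)
    also have "\<dots> \<le> (\<integral>\<^sup>+w. N 0 w \<partial>M)"
      using add_right_mono[OF *] Suc.IH by (rule order_trans)
    finally show ?case .
  qed
  from this[of n] show ?thesis
    unfolding B_def[symmetric] by (auto intro: order_trans[rotated])
qed

text \<open>The events with horizon \<open>n\<close> increase to the event of ever reaching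
  \<open>c\<close>, and the finite-horizon bound does not depend on \<open>n\<close>.\<close>

lemma ville_inequality:
  fixes N :: "nat \<Rightarrow> 'w \<Rightarrow> ennreal"
  assumes sub: "\<And>t. subalgebra M (F t)"
    and mono: "\<And>s t. s \<le> t \<Longrightarrow> sets (F s) \<subseteq> sets (F t)"
    and adapted: "\<And>t. N t \<in> borel_measurable (F t)"
    and step: "\<And>t Z. Z \<in> borel_measurable (F t) \<Longrightarrow>
      (\<integral>\<^sup>+w. Z w * N (Suc t) w \<partial>M) \<le> (\<integral>\<^sup>+w. Z w * N t w \<partial>M)"
  shows "c * emeasure M {w \<in> space M. \<exists>t. c \<le> N t w} \<le> (\<integral>\<^sup>+w. N 0 w \<partial>M)"
proof -
  have N_M [measurable]: "N t \<in> borel_measurable M" for t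
    using measurable_from_subalg[OF sub adapted] .
  have "(SUP n. emeasure M {w \<in> space M. \<exists>j\<le>n. c \<le> N j w})
      = emeasure M (\<Union>n. {w \<in> space M. \<exists>j\<le>n. c \<le> N j w})"
    by (intro SUP_emeasure_incseq) (auto simp: incseq_def intro: order_trans)
  also have "(\<Union>n. {w \<in> space M. \<exists>j\<le>n. c \<le> N j w}) = {w \<in> space M. \<exists>t. c \<le> N t w}"
    by auto
  finally have "c * emeasure M {w \<in> space M. \<exists>t. c \<le> N t w}
      = (SUP n. c * emeasure M {w \<in> space M. \<exists>j\<le>n. c \<le> N j w})"
    by (simp flip: SUP_mult_left_ennreal)
  also have "\<dots> \<le> (\<integral>\<^sup>+w. N 0 w \<partial>M)"
    using ville_finite_horizon[where F = F and N = N and M = M, OF assms] by (intro SUP_least)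
  finally show ?thesis .
qed

section \<open>Exponential mixture over the unit ball\<close>

text \<open>For \<open>0 < r\<close> this is Jensen's inequality for the uniform distribution on the
  ball, whose mean is \<open>c\<close>. Pairing \<open>u\<close> with its mirror image
  \<open>2 *\<^sub>R c - u\<close> reduces it to a pointwise bound.\<close>

lemma nn_integral_cball_exp_inner_ge:
  fixes c s :: "'a::euclidean_space"
  shows "ennreal (exp (c \<bullet> s)) * emeasure lborel (cball c r)
    \<le> (\<integral>\<^sup>+u\<in>cball c r. ennreal (exp (u \<bullet> s)) \<partial>lborel)"
proof -
  define f where "f u = ennreal (exp (u \<bullet> s)) * indicator (cball c r) u" for u :: 'a
  have [measurable]: "f \<in> borel_measurable borel"
    unfolding f_def by (intro borel_measurable_times_ennreal borel_measurable_indicator) auto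
  define g where "g u = f (2 *\<^sub>R c + (-1) *\<^sub>R u)" for u
  have [measurable]: "g \<in> borel_measurable borel"
    unfolding g_def by measurable
  \<comment> \<open>Point reflection in \<open>c\<close> is affine with factor -1, so it preserves
    Lebesgue measure.\<close>
  have "(\<integral>\<^sup>+u. f u \<partial>lborel)
      = (\<integral>\<^sup>+u. f u \<partial>distr lborel borel (\<lambda>x. 2 *\<^sub>R c + (-1) *\<^sub>R x))"
    using lborel_affine[of "-1" "2 *\<^sub>R c"] by (simp add: density_1)
  also have "\<dots> = (\<integral>\<^sup>+u. g u \<partial>lborel)"
    unfolding g_def by (subst nn_integral_distr) auto
  finally have reflect: "(\<integral>\<^sup>+u. f u \<partial>lborel) = (\<integral>\<^sup>+u. g u \<partial>lborel)" .
  have pair: "2 * ennreal (exp (c \<bullet> s)) * indicator (cball c r) u \<le> f u + g u" for u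
  proof -
    \<comment> \<open>With \<open>a\<close> the increment of the exponent from \<open>c\<close> to
      \<open>u\<close>, the two mirror points contribute \<open>exp a\<close> and
      \<open>exp (- a)\<close> times the value at \<open>c\<close>.\<close>
    define a where "a = (u - c) \<bullet> s"
    have "2 \<le> exp a + exp (- a)"
      using exp_ge_add_one_self[of a] exp_ge_add_one_self[of "- a"] by linarith
    then have "exp (c \<bullet> s) * 2 \<le> exp (c \<bullet> s) * (exp a + exp (- a))"
      by (rule mult_left_mono) simp
    also have "\<dots> = exp (u \<bullet> s) + exp ((2 *\<^sub>R c - u) \<bullet> s)"
      by (simp add: a_def distrib_left inner_diff_left flip: exp_add)
    finally have "ennreal (2 * exp (c \<bullet> s))
        \<le> ennreal (exp (u \<bullet> s) + exp ((2 *\<^sub>R c - u) \<bullet> s))"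
      by (intro ennreal_leI) (simp add: mult.commute)
    moreover have "2 *\<^sub>R c - u \<in> cball c r \<longleftrightarrow> u \<in> cball c r"
      by (simp add: dist_norm scaleR_2 algebra_simps norm_minus_commute)
    ultimately show ?thesis
      by (auto simp: f_def g_def ennreal_mult split: split_indicator)
  qed
  have "2 * (ennreal (exp (c \<bullet> s)) * emeasure lborel (cball c r))
      = (\<integral>\<^sup>+u. 2 * ennreal (exp (c \<bullet> s)) * indicator (cball c r) u \<partial>lborel)"
    by (subst nn_integral_cmult_indicator) (auto simp: mult.assoc)
  also have "\<dots> \<le> (\<integral>\<^sup>+u. f u + g u \<partial>lborel)"
    using pair by (intro nn_integral_mono)
  also have "\<dots> = 2 * (\<integral>\<^sup>+u. f u \<partial>lborel)"
    by (subst nn_integral_add) (auto simp: reflect[symmetric] mult_2)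
  finally show ?thesis
    unfolding f_def by (simp add: ennreal_mult_le_mult_iff)
qed

text \<open>The model enters only through \<open>step\<close>, the supermartingale property for each
  fixed \<open>u\<close> in the unit ball. Mixing over \<open>u\<close> makes a single process
  control all directions at once, hence the norm of \<open>S t\<close>.\<close>

lemma mixture_bound:
  fixes S :: "nat \<Rightarrow> 'w \<Rightarrow> 'a::euclidean_space" and C :: "nat \<Rightarrow> 'w \<Rightarrow> real"
  assumes "prob_space M"
    and sub: "\<And>t. subalgebra M (F t)"
    and mono: "\<And>s t. s \<le> t \<Longrightarrow> sets (F s) \<subseteq> sets (F t)"
    and S_F: "\<And>t. S t \<in> borel_measurable (F t)"
    and C_F: "\<And>t. C t \<in> borel_measurable (F t)"
    and init: "\<And>w. S 0 w = 0" "\<And>w. C 0 w = 0"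
    and step: "\<And>t u Z. norm u \<le> 1 \<Longrightarrow> Z \<in> borel_measurable (F t) \<Longrightarrow>
      (\<integral>\<^sup>+w. Z w * ennreal (exp (u \<bullet> S (Suc t) w - C (Suc t) w)) \<partial>M)
      \<le> (\<integral>\<^sup>+w. Z w * ennreal (exp (u \<bullet> S t w - C t w)) \<partial>M)"
    and \<epsilon>: "0 < \<epsilon>" "\<epsilon> < 1" and \<alpha>: "0 < \<alpha>"
  shows "emeasure M {w \<in> space M. \<exists>t. C t w + real DIM('a) * ln (1 / \<epsilon>) + ln (1 / \<alpha>)
    < (1 - \<epsilon>) * norm (S t w)} \<le> ennreal \<alpha>"
proof -
  interpret prob_space M by fact
  interpret pair_sigma_finite M "lborel :: 'a measure" ..
  define E where "E t w u = ennreal (exp (u \<bullet> S t w - C t w)) * indicator (cball 0 1) u" for t w u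
  \<comment> \<open>Lebesgue measure on the ball is left unnormalised: \<open>N\<close> starts at
    the volume \<open>m\<close> instead of 1, which is why the level used below is
    \<open>m / \<alpha>\<close>.\<close>
  define N where "N t w = (\<integral>\<^sup>+u. E t w u \<partial>lborel)" for t w
  define m where "m = unit_ball_vol (real DIM('a))"
  have m: "0 < m"
    by (simp add: m_def)
  have emeasure_ball: "emeasure lborel (cball c r :: 'a set) = ennreal (m * r ^ DIM('a))" if "0 \<le> r" for c r
    using that by (simp add: m_def emeasure_cball)
  have space_F: "space (F t) = space M" for t
    using sub by (auto simp: subalgebra_def)
  have S_M [measurable]: "S t \<in> borel_measurable M" for t
    using measurable_from_subalg[OF sub S_F] .
  have C_M [measurable]: "C t \<in> borel_measurable M" for t
    using measurable_from_subalg[OF sub C_F] .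
  have cball_meas [measurable]: "(\<lambda>p. indicator (cball (0::'a) 1) (snd p) :: ennreal) \<in> borel_measurable (A \<Otimes>\<^sub>M lborel)"
    for A :: "'w measure"
    by (rule measurable_compose[OF measurable_snd]) (auto intro: borel_measurable_indicator)
  \<comment> \<open>Joint measurability over \<open>F t\<close>, not only over \<open>M\<close>, is
    what makes the mixture adapted.\<close>
  have E_F: "(\<lambda>p. E t (fst p) (snd p)) \<in> borel_measurable (F t \<Otimes>\<^sub>M lborel)" for t
    using S_F[of t] C_F[of t] unfolding E_def by measurable
  have E_M [measurable]: "(\<lambda>p. E t (fst p) (snd p)) \<in> borel_measurable (M \<Otimes>\<^sub>M lborel)" for t
    unfolding E_def by measurable
  have N_F: "N t \<in> borel_measurable (F t)" for t
    using lborel.borel_measurable_nn_integral_fst[OF E_F[of t]] by (simp add: N_def[abs_def])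
  have N_step: "(\<integral>\<^sup>+w. Z w * N (Suc t) w \<partial>M) \<le> (\<integral>\<^sup>+w. Z w * N t w \<partial>M)"
    if Z: "Z \<in> borel_measurable (F t)" for t Z
  proof -
    have Z_M [measurable]: "Z \<in> borel_measurable M"
      using measurable_from_subalg[OF sub Z] .
    \<comment> \<open>Tonelli moves the integral over \<open>u\<close> outside, where
      \<open>step\<close> applies to each \<open>u\<close> in the ball separately; outside the ball
      both integrands vanish.\<close>
    have swap: "(\<integral>\<^sup>+w. Z w * N s w \<partial>M) = (\<integral>\<^sup>+u. (\<integral>\<^sup>+w. Z w * E s w u \<partial>M) \<partial>lborel)" for s
    proof -
      have "(\<integral>\<^sup>+w. Z w * N s w \<partial>M) = (\<integral>\<^sup>+w. (\<integral>\<^sup>+u. Z w * E s w u \<partial>lborel) \<partial>M)"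
      proof (intro nn_integral_cong)
        fix w assume "w \<in> space M"
        then have "E s w \<in> borel_measurable lborel"
          using measurable_compose[OF measurable_Pair1' E_M[of s]] by simp
        then show "Z w * N s w = (\<integral>\<^sup>+u. Z w * E s w u \<partial>lborel)"
          by (simp add: N_def nn_integral_cmult)
      qed
      also have "\<dots> = (\<integral>\<^sup>+u. (\<integral>\<^sup>+w. Z w * E s w u \<partial>M) \<partial>lborel)"
        by (rule Fubini'[symmetric]) (simp add: case_prod_beta)
      finally show ?thesis .
    qed
    show ?thesis
      unfolding swap
    proof (rule nn_integral_mono)
      fix u :: 'a
      show "(\<integral>\<^sup>+w. Z w * E (Suc t) w u \<partial>M) \<le> (\<integral>\<^sup>+w. Z w * E t w u \<partial>M)"
        using step[OF _ Z, of u] by (cases "u \<in> cball 0 1") (auto simp: E_def)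
    qed
  qed
  have N_ge: "ennreal (exp ((1 - \<epsilon>) * norm (S t w) - C t w)) * ennreal (m * \<epsilon> ^ DIM('a)) \<le> N t w" for t w
  proof -
    \<comment> \<open>Pulling the centre back from the sphere by \<open>\<epsilon>\<close> keeps the
      ball of radius \<open>\<epsilon>\<close> inside the unit ball, at the price of the factor
      \<open>1 - \<epsilon>\<close>. For \<open>S t w = 0\<close> the convention
      \<open>sgn 0 = 0\<close> puts the centre at the origin.\<close>
    define c where "c = (1 - \<epsilon>) *\<^sub>R sgn (S t w)"
    have c_inner: "c \<bullet> S t w = (1 - \<epsilon>) * norm (S t w)"
      by (cases "S t w = 0") (simp_all add: c_def sgn_div_norm dot_square_norm power2_eq_square)
    have "norm c \<le> 1 - \<epsilon>"
      using \<epsilon> by (auto simp: c_def norm_sgn)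
    then have sub: "cball c \<epsilon> \<subseteq> cball 0 1"
      by (subst cball_subset_cball_iff) auto
    have [measurable]: "(indicator (cball c \<epsilon>) :: 'a \<Rightarrow> ennreal) \<in> borel_measurable borel"
      by (auto intro: borel_measurable_indicator)
    have "ennreal (exp ((1 - \<epsilon>) * norm (S t w) - C t w)) * ennreal (m * \<epsilon> ^ DIM('a))
        = ennreal (exp (- C t w)) * (ennreal (exp (c \<bullet> S t w)) * emeasure lborel (cball c \<epsilon>))"
      using \<epsilon> by (simp add: emeasure_ball c_inner flip: mult.assoc ennreal_mult exp_add)
    also have "\<dots> \<le> ennreal (exp (- C t w)) * (\<integral>\<^sup>+u\<in>cball c \<epsilon>. ennreal (exp (u \<bullet> S t w)) \<partial>lborel)"
      by (intro mult_left_mono nn_integral_cball_exp_inner_ge) simp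
    also have "\<dots> = (\<integral>\<^sup>+u. ennreal (exp (- C t w)) * (ennreal (exp (u \<bullet> S t w)) * indicator (cball c \<epsilon>) u) \<partial>lborel)"
      by (intro nn_integral_cmult[symmetric]) measurable
    also have "\<dots> \<le> N t w"
      unfolding N_def E_def using sub
      by (intro nn_integral_mono)
        (auto simp: subset_iff simp flip: mult.assoc ennreal_mult exp_add split: split_indicator)
    finally show ?thesis .
  qed
  have "ennreal (m / \<alpha>) * emeasure M {w \<in> space M. \<exists>t. ennreal (m / \<alpha>) \<le> N t w} \<le> (\<integral>\<^sup>+w. N 0 w \<partial>M)"
    by (rule ville_inequality[where F = F, OF sub mono N_F N_step]) 
  also have "\<dots> = ennreal m"
    by (simp add: N_def E_def init emeasure_space_1 emeasure_ball)
  finally have "ennreal (\<alpha> / m) * (ennreal (m / \<alpha>) * emeasure M {w \<in> space M. \<exists>t. ennreal (m / \<alpha>) \<le> N t w})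
      \<le> ennreal (\<alpha> / m) * ennreal m"
    by (rule mult_left_mono) simp
  then have "emeasure M {w \<in> space M. \<exists>t. ennreal (m / \<alpha>) \<le> N t w} \<le> ennreal \<alpha>"
    using m \<alpha> by (simp flip: mult.assoc ennreal_mult)
  moreover have "emeasure M {w \<in> space M. \<exists>t. C t w + real DIM('a) * ln (1 / \<epsilon>) + ln (1 / \<alpha>)
      < (1 - \<epsilon>) * norm (S t w)} \<le> emeasure M {w \<in> space M. \<exists>t. ennreal (m / \<alpha>) \<le> N t w}"
  proof (rule emeasure_mono)
    have [measurable]: "N t \<in> borel_measurable M" for t
      using measurable_from_subalg[OF sub N_F] .
    show "{w \<in> space M. \<exists>t. ennreal (m / \<alpha>) \<le> N t w} \<in> sets M"
      by measurable
    show "{w \<in> space M. \<exists>t. C t w + real DIM('a) * ln (1 / \<epsilon>) + ln (1 / \<alpha>) < (1 - \<epsilon>) * norm (S t w)}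
        \<subseteq> {w \<in> space M. \<exists>t. ennreal (m / \<alpha>) \<le> N t w}"
    proof safe
      fix w t
      assume *: "C t w + real DIM('a) * ln (1 / \<epsilon>) + ln (1 / \<alpha>) < (1 - \<epsilon>) * norm (S t w)"
      \<comment> \<open>The term with \<open>ln (1 / \<epsilon>)\<close> compensates the volume
        fraction \<open>\<epsilon> ^ DIM('a)\<close>, and \<open>ln (1 / \<alpha>)\<close> supplies
        the level.\<close>
      have "m / \<alpha> = exp (real DIM('a) * ln (1 / \<epsilon>) + ln (1 / \<alpha>)) * (m * \<epsilon> ^ DIM('a))"
        using \<epsilon> \<alpha> by (simp add: exp_add exp_of_nat_mult power_one_over field_simps)
      also have "\<dots> \<le> exp ((1 - \<epsilon>) * norm (S t w) - C t w) * (m * \<epsilon> ^ DIM('a))"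
        using * \<epsilon> m by (intro mult_right_mono) auto
      finally have "ennreal (m / \<alpha>) \<le> ennreal (exp ((1 - \<epsilon>) * norm (S t w) - C t w) * (m * \<epsilon> ^ DIM('a)))"
        by (rule ennreal_leI)
      also have "\<dots> = ennreal (exp ((1 - \<epsilon>) * norm (S t w) - C t w)) * ennreal (m * \<epsilon> ^ DIM('a))"
        using \<epsilon> m by (intro ennreal_mult) auto
      also have "\<dots> \<le> N t w"
        by (rule N_ge)
      finally show "\<exists>t. ennreal (m / \<alpha>) \<le> N t w" ..
    qed
  qed
  ultimately show ?thesis
    by (rule order_trans[rotated])
qed

section \<open>Predictable step sizes\<close>

text \<open>Measurability of \<open>\<psi>\<close> comes from monotonicity:
  \<open>\<psi> l / l\<^sup>2\<close> is monotone, hence Borel, on the range of \<open>L\<close>,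
  and the factor \<open>(L w)\<^sup>2\<close> is multiplied back.\<close>

lemma super_gaussian_measurable:
  assumes sg: "super_gaussian lmax \<psi>"
    and L [measurable]: "L \<in> borel_measurable F"
    and L_range: "\<And>w. w \<in> space F \<Longrightarrow> 0 < L w \<and> ereal (L w) < lmax"
  shows "(\<lambda>w. \<psi> (L w)) \<in> borel_measurable F"
proof -
  have "(\<lambda>l. \<psi> l / l\<^sup>2) \<in> borel_measurable (restrict_space borel {l. 0 < l \<and> ereal l < lmax})"
    using sg unfolding super_gaussian_def by (rule borel_measurable_mono_on_fnc)
  moreover have "L \<in> measurable F (restrict_space borel {l. 0 < l \<and> ereal l < lmax})"
    using L_range by (intro measurable_restrict_space2) auto
  ultimately have [measurable]: "(\<lambda>w. \<psi> (L w) / (L w)\<^sup>2) \<in> borel_measurable F"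
    by (rule measurable_compose[rotated])
  have "(\<lambda>w. \<psi> (L w) / (L w)\<^sup>2 * (L w)\<^sup>2) \<in> borel_measurable F"
    by measurable
  then show ?thesis
    using L_range by (subst measurable_cong[where g = "\<lambda>w. \<psi> (L w) / (L w)\<^sup>2 * (L w)\<^sup>2"]) force+
qed

text \<open>The defining property of \<open>nn_cond_exp\<close> turns a conditional bound into the
  weak form tested against \<open>Z\<close>, in which the supermartingale arguments are
  stated.\<close>

lemma (in sigma_finite_subalgebra) nn_integral_mult_le_of_nn_cond_exp_le_one:
  assumes "AE w in M. nn_cond_exp M F f w \<le> 1"
    and "f \<in> borel_measurable M" "Z \<in> borel_measurable F"
  shows "(\<integral>\<^sup>+w. Z w * f w \<partial>M) \<le> (\<integral>\<^sup>+w. Z w \<partial>M)"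
proof -
  have "(\<integral>\<^sup>+w. Z w * f w \<partial>M) = (\<integral>\<^sup>+w. Z w * nn_cond_exp M F f w \<partial>M)"
    using assms by (simp add: nn_cond_exp_intg)
  also have "\<dots> \<le> (\<integral>\<^sup>+w. Z w \<partial>M)"
  proof (rule nn_integral_mono_AE)
    show "AE w in M. Z w * nn_cond_exp M F f w \<le> Z w"
      using assms(1)
    proof eventually_elim
      case (elim w)
      then show ?case
        using mult_left_mono[OF elim, of "Z w"] by simp
    qed
  qed
  finally show ?thesis .
qed

lemma floor_dyadic_tendsto:
  fixes x :: real
  shows "(\<lambda>n. of_int \<lfloor>2 ^ n * x\<rfloor> / 2 ^ n) \<longlonglongrightarrow> x"
proof (rule tendsto_sandwich)
  show "\<forall>\<^sub>F n in sequentially. x - (1 / 2) ^ n \<le> of_int \<lfloor>2 ^ n * x\<rfloor> / 2 ^ n"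
  proof (intro always_eventually allI)
    fix n
    have "x - (1 / 2) ^ n = (2 ^ n * x - 1) / 2 ^ n"
      by (simp add: diff_divide_distrib power_one_over)
    also have "\<dots> \<le> of_int \<lfloor>2 ^ n * x\<rfloor> / 2 ^ n"
      by (intro divide_right_mono) (linarith, simp)
    finally show "x - (1 / 2) ^ n \<le> of_int \<lfloor>2 ^ n * x\<rfloor> / 2 ^ n" .
  qed
  show "\<forall>\<^sub>F n in sequentially. of_int \<lfloor>2 ^ n * x\<rfloor> / 2 ^ n \<le> x"
    by (intro always_eventually allI) (simp add: field_simps)
  have "(\<lambda>n. x - (1 / 2) ^ n) \<longlonglongrightarrow> x - 0"
    by (intro tendsto_intros LIMSEQ_power_zero) auto
  then show "(\<lambda>n. x - (1 / 2) ^ n) \<longlonglongrightarrow> x"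
    by simp
qed auto

text \<open>On the event \<open>K w = k\<close> the integrand uses one fixed \<open>f k\<close>, and
  \<open>Z\<close> cut off to that event is still an \<open>F\<close>-measurable weight; summing
  over the countably many events restores \<open>Z\<close>. This extends a bound for fixed
  parameters to random ones with countably many values.\<close>

lemma nn_integral_countable_mixture_le:
  fixes K :: "'w \<Rightarrow> nat" and f :: "nat \<Rightarrow> 'w \<Rightarrow> ennreal"
  assumes sub: "subalgebra M F"
    and K: "K \<in> measurable F (count_space UNIV)"
    and f: "\<And>k. f k \<in> borel_measurable M"
    and f_le: "\<And>k Z. Z \<in> borel_measurable F \<Longrightarrow> (\<integral>\<^sup>+w. Z w * f k w \<partial>M) \<le> (\<integral>\<^sup>+w. Z w \<partial>M)"
    and Z: "Z \<in> borel_measurable F"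
  shows "(\<integral>\<^sup>+w. Z w * f (K w) w \<partial>M) \<le> (\<integral>\<^sup>+w. Z w \<partial>M)"
proof -
  define Zk where "Zk k w = (if k = K w then Z w else 0)" for k w
  have Zk_F: "Zk k \<in> borel_measurable F" for k
    unfolding Zk_def[abs_def] using K Z by measurable
  have [measurable]: "Zk k \<in> borel_measurable M" "f k \<in> borel_measurable M" for k
    using measurable_from_subalg[OF sub Zk_F] f by auto
  have decomp: "(\<Sum>k. Zk k w * g k) = Z w * g (K w)" for w and g :: "nat \<Rightarrow> ennreal"
    using sums_single[of "K w" "\<lambda>k. Z w * g k"]
    by (simp add: Zk_def if_distrib[of "\<lambda>z. z * _"] sums_iff cong: if_cong)
  have "(\<integral>\<^sup>+w. Z w * f (K w) w \<partial>M) = (\<integral>\<^sup>+w. (\<Sum>k. Zk k w * f k w) \<partial>M)"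
    by (simp add: decomp[of _ "\<lambda>k. f k _"])
  also have "\<dots> = (\<Sum>k. \<integral>\<^sup>+w. Zk k w * f k w \<partial>M)"
    by (intro nn_integral_suminf) measurable
  also have "\<dots> \<le> (\<Sum>k. \<integral>\<^sup>+w. Zk k w \<partial>M)"
    by (intro suminf_le f_le Zk_F summableI)
  also have "\<dots> = (\<integral>\<^sup>+w. (\<Sum>k. Zk k w) \<partial>M)"
    by (intro nn_integral_suminf[symmetric]) measurable
  also have "\<dots> = (\<integral>\<^sup>+w. Z w \<partial>M)"
    using decomp[of _ "\<lambda>_. 1"] by simp
  finally show ?thesis .
qed

text \<open>The hypothesis on fixed \<open>l\<close> holds outside a null set depending on \<open>l\<close>, and \<open>\<psi>\<close> may jump.
  So \<open>r L\<close> is approximated by dyadic values from below, where monotonicity of \<open>\<psi> l / l\<^sup>2\<close> is on the right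
  side, and the limit is taken with Fatou's lemma.\<close>

lemma nn_integral_exp_predictable_le:
  fixes Y Q L :: "'w \<Rightarrow> real"
  assumes sub: "subalgebra M F"
    and sg: "super_gaussian lmax \<psi>"
    and Y [measurable]: "Y \<in> borel_measurable M"
    and Q [measurable]: "Q \<in> borel_measurable M"
    and Q_nonneg: "\<And>w. w \<in> space M \<Longrightarrow> 0 \<le> Q w"
    and fixed_l: "\<And>l Z. 0 < l \<Longrightarrow> ereal l < lmax \<Longrightarrow> Z \<in> borel_measurable F \<Longrightarrow>
      (\<integral>\<^sup>+w. Z w * ennreal (exp (l * Y w - \<psi> l * Q w)) \<partial>M) \<le> (\<integral>\<^sup>+w. Z w \<partial>M)"
    and L: "L \<in> borel_measurable F"
    and L_range: "\<And>w. w \<in> space M \<Longrightarrow> 0 < L w \<and> ereal (L w) < lmax"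
    and r: "0 \<le> r" "r \<le> 1"
    and Z: "Z \<in> borel_measurable F"
  shows "(\<integral>\<^sup>+w. Z w * ennreal (exp (r * L w * Y w - r\<^sup>2 * \<psi> (L w) * Q w)) \<partial>M) \<le> (\<integral>\<^sup>+w. Z w \<partial>M)"
proof -
  have space_F: "space F = space M"
    using sub by (simp add: subalgebra_def)
  have \<psi>L_M [measurable]: "(\<lambda>w. \<psi> (L w)) \<in> borel_measurable M"
    using measurable_from_subalg[OF sub super_gaussian_measurable[OF sg L]] L_range by (simp add: space_F)
  have [measurable]: "L \<in> borel_measurable M" "Z \<in> borel_measurable M"
    using measurable_from_subalg[OF sub] L Z by auto
  define a where "a n w = real_of_int \<lfloor>2 ^ n * (r * L w)\<rfloor> / 2 ^ n" for n :: nat and w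
  have [measurable]: "a n \<in> borel_measurable M" for n
    unfolding a_def[abs_def] by measurable
  \<comment> \<open>For \<open>0 < a n w\<close> the coefficient
    \<open>(a n w)\<^sup>2 * (\<psi> (L w) / (L w)\<^sup>2)\<close> dominates
    \<open>\<psi> (a n w)\<close>. Unlike the latter it is continuous in \<open>a n w\<close>, so
    the limit can be taken although \<open>\<psi>\<close> may jump.\<close>
  define h where "h n w = ennreal (exp (a n w * Y w - (a n w)\<^sup>2 * (\<psi> (L w) / (L w)\<^sup>2) * Q w))" for n w
  have [measurable]: "h n \<in> borel_measurable M" for n
    unfolding h_def[abs_def] by measurable
  have h_le: "(\<integral>\<^sup>+w. Z w * h n w \<partial>M) \<le> (\<integral>\<^sup>+w. Z w \<partial>M)" for n
  proof -
    define K where "K w = nat \<lfloor>2 ^ n * (r * L w)\<rfloor>" for w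
    \<comment> \<open>The value 1 at \<open>k = 0\<close> agrees with \<open>h\<close> there, where
      \<open>super_gaussian\<close> gives no information on \<open>\<psi>\<close>. The value 0 is a
      default for arguments beyond \<open>lmax\<close>; \<open>K w / 2 ^ n\<close> stays below
      \<open>lmax\<close>.\<close>
    define f where "f k w =
      (if k = 0 then 1
       else if ereal (real k / 2 ^ n) < lmax
       then ennreal (exp (real k / 2 ^ n * Y w - \<psi> (real k / 2 ^ n) * Q w)) else 0)" for k w
    have "(\<integral>\<^sup>+w. Z w * h n w \<partial>M) \<le> (\<integral>\<^sup>+w. Z w * f (K w) w \<partial>M)"
    proof (intro nn_integral_mono mult_left_mono)
      fix w assume w: "w \<in> space M"
      have L_pos: "0 < L w" and L_less: "ereal (L w) < lmax"
        using L_range[OF w] by auto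
      have a_K: "a n w = real (K w) / 2 ^ n"
        using r L_pos by (simp add: a_def K_def)
      show "h n w \<le> f (K w) w"
      proof (cases "K w = 0")
        case True
        then show ?thesis
          by (simp add: h_def f_def a_K)
      next
        case False
        then have a_pos: "0 < a n w"
          by (simp add: a_K)
        have "of_int \<lfloor>2 ^ n * (r * L w)\<rfloor> \<le> 2 ^ n * (r * L w)"
          by simp
        then have "a n w \<le> r * L w"
          by (simp add: a_def field_simps)
        also have "\<dots> \<le> L w"
          using r L_pos by (simp add: mult_left_le_one_le)
        finally have a_le: "a n w \<le> L w" .
        then have a_less: "ereal (a n w) < lmax"
          using L_less by (metis ereal_less_eq(3) order.strict_trans1)
        have "\<psi> (a n w) / (a n w)\<^sup>2 \<le> \<psi> (L w) / (L w)\<^sup>2"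
          using sg a_pos a_less L_pos L_less a_le
          unfolding super_gaussian_def by (auto elim!: mono_onD)
        then have "\<psi> (a n w) \<le> (a n w)\<^sup>2 * (\<psi> (L w) / (L w)\<^sup>2)"
          using a_pos by (simp add: pos_divide_le_eq mult.commute)
        then have "\<psi> (a n w) * Q w \<le> (a n w)\<^sup>2 * (\<psi> (L w) / (L w)\<^sup>2) * Q w"
          using Q_nonneg[OF w] by (rule mult_right_mono)
        then show ?thesis
          using False a_less by (auto simp: h_def f_def a_K[symmetric] intro!: ennreal_leI)
      qed
    qed simp
    also have "\<dots> \<le> (\<integral>\<^sup>+w. Z w \<partial>M)"
    proof (rule nn_integral_countable_mixture_le[OF sub _ _ _ Z])
      show "K \<in> measurable F (count_space UNIV)"
        unfolding K_def[abs_def] using L by measurable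
      show "f k \<in> borel_measurable M" for k
        unfolding f_def[abs_def] by measurable
      show "(\<integral>\<^sup>+w. Z' w * f k w \<partial>M) \<le> (\<integral>\<^sup>+w. Z' w \<partial>M)" if "Z' \<in> borel_measurable F" for k Z'
      proof (cases "0 < k \<and> ereal (real k / 2 ^ n) < lmax")
        case True
        then show ?thesis
          using fixed_l[OF _ _ that, of "real k / 2 ^ n"] by (simp add: f_def)
      next
        case False
        then show ?thesis
          by (cases "k = 0") (simp_all add: f_def)
      qed
    qed
    finally show ?thesis .
  qed
  have lim: "(\<lambda>n. Z w * h n w) \<longlonglongrightarrow> Z w * ennreal (exp (r * L w * Y w - r\<^sup>2 * \<psi> (L w) * Q w))"
    if w: "w \<in> space M" for w
  proof -
    have "(\<lambda>n. a n w) \<longlonglongrightarrow> r * L w"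
      unfolding a_def by (rule floor_dyadic_tendsto)
    then have "(\<lambda>n. h n w) \<longlonglongrightarrow>
        ennreal (exp (r * L w * Y w - (r * L w)\<^sup>2 * (\<psi> (L w) / (L w)\<^sup>2) * Q w))"
      unfolding h_def by (intro tendsto_intros)
    also have "(r * L w)\<^sup>2 * (\<psi> (L w) / (L w)\<^sup>2) = r\<^sup>2 * \<psi> (L w)"
      using L_range[OF w] by (simp add: power_mult_distrib)
    \<comment> \<open>The limit of \<open>h n w\<close> is positive and finite, so the product
      converges even where \<open>Z w\<close> is 0 or infinite.\<close>
    finally show ?thesis
      by (intro tendsto_mult_ennreal tendsto_const) (auto simp: ennreal_eq_0_iff not_le)
  qed
  have "(\<integral>\<^sup>+w. Z w * ennreal (exp (r * L w * Y w - r\<^sup>2 * \<psi> (L w) * Q w)) \<partial>M)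
      = (\<integral>\<^sup>+w. liminf (\<lambda>n. Z w * h n w) \<partial>M)"
    using lim by (intro nn_integral_cong lim_imp_Liminf[symmetric]) auto
  also have "\<dots> \<le> liminf (\<lambda>n. \<integral>\<^sup>+w. Z w * h n w \<partial>M)"
    by (intro nn_integral_liminf) measurable
  also have "\<dots> \<le> (\<integral>\<^sup>+w. Z w \<partial>M)"
    using Liminf_mono[of "\<lambda>n. \<integral>\<^sup>+w. Z w * h n w \<partial>M" "\<lambda>_. \<integral>\<^sup>+w. Z w \<partial>M" sequentially] h_le
    by (simp add: Liminf_const)
  finally show ?thesis .
qed

section \<open>The natural filtration\<close>

lemma measurable_nat_filt:
  assumes "i \<in> {1..t}"
  shows "X i \<in> borel_measurable (nat_filt M X t)"
proof (rule measurableI)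
  show "X i -` A \<inter> space (nat_filt M X t) \<in> sets (nat_filt M X t)" if "A \<in> sets borel" for A
    using assms that unfolding nat_filt_def
    by (subst sets_measure_of) (auto simp: space_measure_of_conv)
qed auto

lemma space_nat_filt: "space (nat_filt M X t) = space M"
  by (simp add: nat_filt_def space_measure_of_conv)

lemma sets_nat_filt_mono:
  assumes "s \<le> t"
  shows "sets (nat_filt M X s) \<subseteq> sets (nat_filt M X t)"
proof -
  let ?G = "\<lambda>t. {X i -` A \<inter> space M | i A. i \<in> {1..t} \<and> A \<in> sets borel}"
  have "?G s \<subseteq> ?G t"
    using assms by (auto intro: order_trans)
  then show ?thesis
    unfolding nat_filt_def by (subst (1 2) sets_measure_of) (auto intro!: sigma_sets_mono')
qed

lemma subalgebra_nat_filt: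
  assumes "\<And>t. 1 \<le> t \<Longrightarrow> X t \<in> borel_measurable M"
  shows "subalgebra M (nat_filt M X t)"
  unfolding subalgebra_def
proof
  show "sets (nat_filt M X t) \<subseteq> sets M"
    unfolding nat_filt_def using assms
    by (subst sets_measure_of) (auto intro!: sets.sigma_sets_subset measurable_sets)
qed (simp add: space_nat_filt)

section \<open>Operator norm and positive semidefinite matrices\<close>

lemma op_norm_triangle: "op_norm (A + B) \<le> op_norm A + op_norm B"
  for A B :: "real ^ 'n ^ 'n"
proof -
  have "onorm (\<lambda>x. A *v x + B *v x) \<le> onorm ((*v) A) + onorm ((*v) B)"
    by (intro onorm_triangle matrix_vector_mul_bounded_linear)
  moreover have "(*v) (A + B) = (\<lambda>x. A *v x + B *v x)"
    by (simp add: fun_eq_iff matrix_vector_mult_add_rdistrib)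
  ultimately show ?thesis
    by (simp add: op_norm_def)
qed

lemma op_norm_le_norm: "op_norm A \<le> real CARD('n) * real CARD('n) * norm A"
  for A :: "real ^ 'n ^ 'n"
  unfolding op_norm_def
  by (rule onorm_le_matrix_component) (rule order_trans[OF component_le_norm_cart Finite_Cartesian_Product.norm_nth_le])

text \<open>This serves to make \<open>op_norm\<close> Borel measurable: the topology of the type
  comes from the Frobenius norm, so continuity in that norm has to be shown. The crude constant
  comes from bounding every entry by the norm.\<close>

lemma op_norm_lipschitz: "(real CARD('n) * real CARD('n))-lipschitz_on UNIV (op_norm :: real ^ 'n ^ 'n \<Rightarrow> real)"
proof (rule lipschitz_onI)
  fix A B :: "real ^ 'n ^ 'n"
  have "op_norm A \<le> op_norm B + op_norm (A - B)" "op_norm B \<le> op_norm A + op_norm (B - A)"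
    using op_norm_triangle[of B "A - B"] op_norm_triangle[of A "B - A"] by auto
  then show "dist (op_norm A) (op_norm B) \<le> real CARD('n) * real CARD('n) * dist A B"
    using op_norm_le_norm[of "A - B"] op_norm_le_norm[of "B - A"]
    by (simp add: dist_norm norm_minus_commute abs_le_iff)
qed simp

lemma borel_measurable_op_norm [measurable]:
  "op_norm \<in> borel_measurable (borel :: (real ^ 'n ^ 'n) measure)"
  using op_norm_lipschitz by (intro borel_measurable_continuous_onI lipschitz_on_continuous_on)

lemma borel_measurable_quadratic_form [measurable (raw)]:
  fixes A :: "'w \<Rightarrow> real ^ 'n ^ 'n"
  assumes "A \<in> borel_measurable M"
  shows "(\<lambda>w. v \<bullet> (A w *v v)) \<in> borel_measurable M"
proof (rule measurable_compose[OF assms])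
  show "(\<lambda>B. v \<bullet> (B *v v)) \<in> borel_measurable borel"
    unfolding matrix_vector_mult_def inner_vec_def
    by (intro borel_measurable_continuous_onI) (auto intro!: continuous_intros)
qed

lemma quadratic_form_le_op_norm:
  fixes u :: "real ^ 'n"
  assumes "norm u \<le> 1"
  shows "u \<bullet> (A *v u) \<le> op_norm A"
proof -
  have "u \<bullet> (A *v u) \<le> norm u * norm (A *v u)"
    by (rule norm_cauchy_schwarz)
  also have "\<dots> \<le> 1 * (op_norm A * norm u)"
    using assms unfolding op_norm_def by (intro mult_mono onorm matrix_vector_mul_bounded_linear) auto
  also have "\<dots> \<le> op_norm A"
    using assms onorm_pos_le[OF matrix_vector_mul_bounded_linear, of A]
    by (simp add: op_norm_def mult_left_le)
  finally show ?thesis .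
qed

lemma axis_quadratic_form: "axis i 1 \<bullet> (A *v axis j 1) = A $ i $ j"
  for A :: "real ^ 'n ^ 'n"
  by (simp add: inner_axis' matrix_vector_mult_basis column_def)

text \<open>With a vanishing diagonal, the quadratic form at
  \<open>axis i 1 + s *\<^sub>R axis j 1\<close> is linear in \<open>s\<close>, namely
  \<open>2 * s * A $ i $ j\<close>, and it has to be nonnegative for both signs of
  \<open>s\<close>.\<close>

lemma pos_semidef_zero_diagonal:
  fixes A :: "real ^ 'n ^ 'n"
  assumes psd: "pos_semidef A" and diag: "\<And>i. A $ i $ i = 0"
  shows "A = 0"
proof -
  have "A $ i $ j = 0" for i j
  proof -
    have sym: "A $ j $ i = A $ i $ j"
    proof -
      have "A $ i $ j = transpose A $ i $ j"
        using psd by (simp only: pos_semidef_def)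
      then show ?thesis
        by (simp add: transpose_def)
    qed
    have "0 \<le> (axis i 1 + s *\<^sub>R axis j 1) \<bullet> (A *v (axis i 1 + s *\<^sub>R axis j 1))" for s :: real
      using psd by (simp add: pos_semidef_def)
    then have "0 \<le> 2 * s * A $ i $ j" for s :: real
      by (simp add: matrix_vector_right_distrib matrix_vector_mult_scaleR inner_add_left inner_add_right
          axis_quadratic_form diag sym)
    from this[of 1] this[of "-1"] show ?thesis
      by simp
  qed
  then show ?thesis
    by (simp add: vec_eq_iff)
qed

section \<open>One-step bound from the sub-\<open>\<psi>\<close> condition\<close>

lemma sub_psiD:
  assumes "sub_psi M F lmax \<psi> \<mu> V X" and "1 \<le> t"
  shows "V t \<in> borel_measurable (F t)"
    and "w \<in> space M \<Longrightarrow> pos_semidef (V t w)"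
    and "norm v = 1 \<Longrightarrow> 0 \<le> l \<Longrightarrow> ereal l < lmax \<Longrightarrow>
      AE w in M. nn_cond_exp M (F (t - 1))
        (\<lambda>w. ennreal (exp (l * (v \<bullet> (X t w - \<mu>)) - \<psi> l * (v \<bullet> (V t w *v v))))) w \<le> 1"
  using assms by (simp_all add: sub_psi_def)

text \<open>Where \<open>\<psi>\<close> is negative, the sub-\<open>\<psi>\<close> bound is the equality case of \<open>1 + x \<le> exp x\<close>.\<close>

lemma sub_psi_negative_imp_zero:
  fixes X :: "nat \<Rightarrow> 'w \<Rightarrow> real ^ 'n" and V :: "nat \<Rightarrow> 'w \<Rightarrow> real ^ 'n ^ 'n"
  assumes "prob_space M"
    and mean: "has_const_cond_mean M (nat_filt M X) X \<mu>"
    and sub_psi: "sub_psi M (nat_filt M X) lmax \<psi> \<mu> V X"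
    and t: "1 \<le> t"
    and l0: "0 < l0" "ereal l0 < lmax" "\<psi> l0 < 0"
  shows "AE w in M. V t w = 0"
proof -
  interpret prob_space M by fact
  have X_int: "integrable M (X s)" if "1 \<le> s" for s
    using mean that by (simp add: has_const_cond_mean_def)
  have sub: "subalgebra M (nat_filt M X s)" for s
    using X_int by (intro subalgebra_nat_filt) auto
  interpret G: finite_measure_subalgebra M "nat_filt M X (t - 1)"
    using sub by unfold_locales
  have [measurable]: "X t \<in> borel_measurable M"
    using X_int[OF t] by auto
  have [measurable]: "V t \<in> borel_measurable M"
    using measurable_from_subalg[OF sub sub_psiD(1)[OF sub_psi t]] .
  have psd: "pos_semidef (V t w)" if "w \<in> space M" for w
    using sub_psiD(2)[OF sub_psi t that] .
  \<comment> \<open>A diagonal entry is the quadratic form at the unit vector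
    \<open>axis k 1\<close>, to which the sub-\<open>\<psi>\<close> bound applies; the other entries
    follow by semidefiniteness.\<close>
  have "AE w in M. V t w $ k $ k = 0" for k
  proof -
    define D where "D w = X t w $ k - \<mu> $ k" for w
    define Q where "Q w = V t w $ k $ k" for w
    define Y where "Y w = l0 * D w - \<psi> l0 * Q w" for w
    have Y_eq: "Y w = l0 * (axis k 1 \<bullet> (X t w - \<mu>)) - \<psi> l0 * (axis k 1 \<bullet> (V t w *v axis k 1))" for w
      by (simp add: Y_def D_def Q_def inner_axis' matrix_vector_mult_basis column_def)
    have [measurable]: "Y \<in> borel_measurable M"
      unfolding Y_eq[abs_def] by measurable
    have Q_nonneg: "0 \<le> Q w" if "w \<in> space M" for w
      using psd[OF that] axis_quadratic_form[of k "V t w" k] by (metis Q_def pos_semidef_def)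
    have Xk_int: "integrable M (\<lambda>w. X t w $ k)"
      using integrable_bounded_linear[OF bounded_linear_vec_nth X_int[OF t]] .
    have cond_mean: "AE w in M. real_cond_exp M (nat_filt M X (t - 1)) (\<lambda>w. X t w $ k) w = \<mu> $ k"
      using mean t unfolding has_const_cond_mean_def by blast
    have "(\<integral>w. X t w $ k \<partial>M) = (\<integral>w. real_cond_exp M (nat_filt M X (t - 1)) (\<lambda>w. X t w $ k) w \<partial>M)"
      using G.real_cond_exp_int(2)[OF Xk_int] by simp
    also have "\<dots> = (\<integral>w. \<mu> $ k \<partial>M)"
      by (intro integral_cong_AE cond_mean) auto
    finally have "(\<integral>w. X t w $ k \<partial>M) = \<mu> $ k"
      by (simp add: prob_space)
    then have D_int: "integrable M D" and D_zero: "(\<integral>w. D w \<partial>M) = 0"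
      using Xk_int by (simp_all add: D_def[abs_def] prob_space)
    have "AE w in M. nn_cond_exp M (nat_filt M X (t - 1)) (\<lambda>w. ennreal (exp (Y w))) w \<le> 1"
      unfolding Y_eq using l0 by (intro sub_psiD(3)[OF sub_psi t]) auto
    \<comment> \<open>Testing the conditional bound against 1 gives mean at most 1 for
      \<open>exp (Y w)\<close>, and with it integrability.\<close>
    then have "(\<integral>\<^sup>+w. 1 * nn_cond_exp M (nat_filt M X (t - 1)) (\<lambda>w. ennreal (exp (Y w))) w \<partial>M) \<le> (\<integral>\<^sup>+w. 1 \<partial>M)"
      by (intro nn_integral_mono_AE) simp
    then have exp_le: "(\<integral>\<^sup>+w. ennreal (exp (Y w)) \<partial>M) \<le> 1"
      by (subst (asm) G.nn_cond_exp_intg) (auto simp: emeasure_space_1)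
    then have exp_int: "integrable M (\<lambda>w. exp (Y w))"
      by (intro integrableI_nonneg) (auto simp: le_less_trans)
    have exp_le': "(\<integral>w. exp (Y w) \<partial>M) \<le> 1"
      using exp_le exp_int by (subst (asm) nn_integral_eq_integral) auto
    \<comment> \<open>\<open>h\<close> has mean at most 0, because \<open>D\<close> has mean 0, yet
      it lies above the nonnegative \<open>- \<psi> l0 * Q w\<close>. The term with \<open>Q\<close>
      stays out of its definition because integrability of \<open>Q\<close> is not known at this
      point.\<close>
    define h where "h w = exp (Y w) - 1 - l0 * D w" for w
    have h_ge: "- \<psi> l0 * Q w \<le> h w" for w
      using exp_ge_add_one_self[of "Y w"] unfolding h_def Y_def by linarith
    have Q_term: "0 \<le> - \<psi> l0 * Q w" if "w \<in> space M" for w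
      using l0 Q_nonneg[OF that] by (intro mult_nonneg_nonneg) auto
    have h_int: "integrable M h"
      unfolding h_def[abs_def] using exp_int D_int by auto
    have "(\<integral>w. h w \<partial>M) \<le> 0"
      using exp_int D_int exp_le' by (simp add: h_def D_zero prob_space)
    moreover have h_nonneg: "AE w in M. 0 \<le> h w"
      by (intro AE_I2 order_trans[OF Q_term h_ge])
    ultimately have "(\<integral>w. h w \<partial>M) = 0"
      using integral_nonneg_AE[OF h_nonneg] by simp
    then have "AE w in M. h w = 0"
      using integral_nonneg_eq_0_iff_AE[OF h_int h_nonneg] by simp
    then show ?thesis
      using AE_space
    proof eventually_elim
      case (elim w)
      then have "\<psi> l0 * Q w = 0"
        using h_ge[of w] Q_term[of w] by simp
      then show ?case
        using l0 by (simp add: Q_def)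
    qed
  qed
  then have "AE w in M. \<forall>k. V t w $ k $ k = 0"
    by (simp add: AE_all_countable)
  then show ?thesis
    using AE_space by eventually_elim (auto intro: pos_semidef_zero_diagonal psd)
qed

text \<open>Multiplying the bound on the quadratic form by a negative \<open>\<psi> (L w)\<close>
  would reverse it. If \<open>\<psi>\<close> is negative somewhere in the range, however,
  \<open>V t\<close> vanishes almost surely and both sides are 0.\<close>

lemma sub_psi_AE_quadratic_form_le:
  fixes X :: "nat \<Rightarrow> 'w \<Rightarrow> real ^ 'n" and V :: "nat \<Rightarrow> 'w \<Rightarrow> real ^ 'n ^ 'n"
  assumes "prob_space M"
    and "has_const_cond_mean M (nat_filt M X) X \<mu>"
    and "sub_psi M (nat_filt M X) lmax \<psi> \<mu> V X"
    and "1 \<le> t"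
    and L_range: "\<And>w. w \<in> space M \<Longrightarrow> 0 < L w \<and> ereal (L w) < lmax"
  shows "AE w in M. \<forall>u. norm u \<le> 1 \<longrightarrow> \<psi> (L w) * (u \<bullet> (V t w *v u)) \<le> \<psi> (L w) * op_norm (V t w)"
proof (cases "\<exists>l0. 0 < l0 \<and> ereal l0 < lmax \<and> \<psi> l0 < 0")
  case True
  then have "AE w in M. V t w = 0"
    using sub_psi_negative_imp_zero[OF assms(1-4)] by auto
  moreover have "op_norm (0 :: real ^ 'n ^ 'n) = 0"
  proof -
    have "(*v) (0 :: real ^ 'n ^ 'n) = (\<lambda>_. 0)"
      by (simp add: fun_eq_iff)
    then show ?thesis
      by (simp add: op_norm_def onorm_zero)
  qed
  ultimately show ?thesis
    by (auto elim!: eventually_mono)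
next
  case False
  then have "0 \<le> \<psi> (L w)" if "w \<in> space M" for w
    using L_range[OF that] by (meson not_less)
  then show ?thesis
    by (intro AE_I2) (auto intro: mult_left_mono quadratic_form_le_op_norm)
qed

text \<open>Writing \<open>u\<close> as its norm times a unit vector \<open>v\<close>, the bound for
  predictable \<open>L\<close> is used with \<open>r = norm u\<close>, since
  \<open>r\<^sup>2\<close> is exactly the scaling of the quadratic form. Passing from the form at
  \<open>u\<close> to \<open>op_norm\<close> can only lower the exponent, almost surely.\<close>

lemma sub_psi_step:
  fixes X :: "nat \<Rightarrow> 'w \<Rightarrow> real ^ 'n" and V :: "nat \<Rightarrow> 'w \<Rightarrow> real ^ 'n ^ 'n"
  assumes M: "prob_space M"
    and sg: "super_gaussian lmax \<psi>"
    and mean: "has_const_cond_mean M (nat_filt M X) X \<mu>"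
    and sub_psi: "sub_psi M (nat_filt M X) lmax \<psi> \<mu> V X"
    and t: "1 \<le> t"
    and L: "L \<in> borel_measurable (nat_filt M X (t - 1))"
    and L_range: "\<And>w. w \<in> space M \<Longrightarrow> 0 < L w \<and> ereal (L w) < lmax"
    and u: "norm u \<le> 1"
    and Z: "Z \<in> borel_measurable (nat_filt M X (t - 1))"
  shows "(\<integral>\<^sup>+w. Z w * ennreal (exp (u \<bullet> (L w *\<^sub>R (X t w - \<mu>)) - \<psi> (L w) * op_norm (V t w))) \<partial>M)
    \<le> (\<integral>\<^sup>+w. Z w \<partial>M)"
proof -
  interpret prob_space M by fact
  have X_M: "X s \<in> borel_measurable M" if "1 \<le> s" for s
    using mean that by (auto simp: has_const_cond_mean_def)
  have sub: "subalgebra M (nat_filt M X s)" for s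
    using X_M by (rule subalgebra_nat_filt)
  interpret G: finite_measure_subalgebra M "nat_filt M X (t - 1)"
    using sub by unfold_locales
  have [measurable]: "X t \<in> borel_measurable M"
    using X_M[OF t] .
  have [measurable]: "V t \<in> borel_measurable M"
    using measurable_from_subalg[OF sub sub_psiD(1)[OF sub_psi t]] .
  \<comment> \<open>For \<open>u = 0\<close> any unit vector serves, since the factor
    \<open>norm u\<close> is 0.\<close>
  obtain v where v: "norm v = 1" "u = norm u *\<^sub>R v"
  proof (cases "u = 0")
    case True
    then show ?thesis
      using that[of "axis undefined 1"] by simp
  next
    case False
    then show ?thesis
      using that[of "sgn u"] by (simp add: norm_sgn sgn_div_norm)
  qed
  define Y where "Y w = v \<bullet> (X t w - \<mu>)" for w
  define Q where "Q w = v \<bullet> (V t w *v v)" for w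
  have Y_M: "Y \<in> borel_measurable M" and Q_M: "Q \<in> borel_measurable M"
    unfolding Y_def[abs_def] Q_def[abs_def] by measurable
  have scaled: "(\<integral>\<^sup>+w. Z w * ennreal (exp (norm u * L w * Y w - (norm u)\<^sup>2 * \<psi> (L w) * Q w)) \<partial>M)
      \<le> (\<integral>\<^sup>+w. Z w \<partial>M)"
  proof (rule nn_integral_exp_predictable_le[OF sub sg Y_M Q_M _ _ L L_range _ u Z])
    show "0 \<le> Q w" if "w \<in> space M" for w
      using sub_psiD(2)[OF sub_psi t that] by (simp add: pos_semidef_def Q_def)
    show "(\<integral>\<^sup>+w. Z' w * ennreal (exp (l * Y w - \<psi> l * Q w)) \<partial>M) \<le> (\<integral>\<^sup>+w. Z' w \<partial>M)"
      if l: "0 < l" "ereal l < lmax" and Z': "Z' \<in> borel_measurable (nat_filt M X (t - 1))" for l Z'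
    proof (rule G.nn_integral_mult_le_of_nn_cond_exp_le_one[OF _ _ Z'])
      show "AE w in M. nn_cond_exp M (nat_filt M X (t - 1)) (\<lambda>w. ennreal (exp (l * Y w - \<psi> l * Q w))) w \<le> 1"
        unfolding Y_def Q_def using l v(1) by (intro sub_psiD(3)[OF sub_psi t]) auto
      show "(\<lambda>w. ennreal (exp (l * Y w - \<psi> l * Q w))) \<in> borel_measurable M"
        using Y_M Q_M by measurable
    qed
  qed auto
  have "AE w in M. \<forall>u. norm u \<le> 1 \<longrightarrow> \<psi> (L w) * (u \<bullet> (V t w *v u)) \<le> \<psi> (L w) * op_norm (V t w)"
    using sub_psi_AE_quadratic_form_le[OF M mean sub_psi t L_range] .
  then have "AE w in M. Z w * ennreal (exp (u \<bullet> (L w *\<^sub>R (X t w - \<mu>)) - \<psi> (L w) * op_norm (V t w)))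
      \<le> Z w * ennreal (exp (norm u * L w * Y w - (norm u)\<^sup>2 * \<psi> (L w) * Q w))"
  proof eventually_elim
    case (elim w)
    have "u \<bullet> (L w *\<^sub>R (X t w - \<mu>)) = norm u * L w * Y w"
      by (subst v(2)) (simp add: Y_def)
    moreover have "u \<bullet> (V t w *v u) = (norm u)\<^sup>2 * Q w"
      by (subst (1 2) v(2)) (simp add: Q_def matrix_vector_mult_scaleR power2_eq_square)
    moreover have "\<psi> (L w) * (u \<bullet> (V t w *v u)) \<le> \<psi> (L w) * op_norm (V t w)"
      using elim u by blast
    ultimately show ?case
      by (intro mult_left_mono ennreal_leI) (auto simp: mult_ac)
  qed
  then show ?thesis
    using scaled by (rule order_trans[OF nn_integral_mono_AE])
qed

section \<open>Assembly of the time-uniform bound\<close>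

theorem theorem2p12:
  fixes M :: "'w measure"
    and lmax :: ereal
    and \<psi> :: "real \<Rightarrow> real"
    and X :: "nat \<Rightarrow> 'w \<Rightarrow> real ^ 'n"
    and V :: "nat \<Rightarrow> 'w \<Rightarrow> real ^ 'n ^ 'n"
    and l :: "nat \<Rightarrow> 'w \<Rightarrow> real"
    and \<mu> :: "real ^ 'n"
    and \<epsilon> \<alpha> :: real
  assumes "prob_space M"
    and "0 < lmax"
    and "super_gaussian lmax \<psi>"
    and "has_const_cond_mean M (nat_filt M X) X \<mu>"
    and "sub_psi M (nat_filt M X) lmax \<psi> \<mu> V X"
    and "predictable (nat_filt M X) l"
    and "\<forall>t\<ge>1. \<forall>w\<in>space M. 0 < l t w \<and> ereal (l t w) < lmax"
    and "0 < \<epsilon>" and "\<epsilon> < 1"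
    and "0 < \<alpha>" and "\<alpha> < 1"
  shows "\<P>(w in M. \<forall>t\<ge>1.
            norm ((\<Sum>i=1..t. l i w *\<^sub>R X i w) /\<^sub>R (\<Sum>i=1..t. l i w) - \<mu>)
            \<le> ((\<Sum>i=1..t. \<psi> (l i w) * op_norm (V i w))
                 + real CARD('n) * ln (1 / \<epsilon>) + ln (1 / \<alpha>))
              / ((1 - \<epsilon>) * (\<Sum>i=1..t. l i w)))
         \<ge> 1 - \<alpha>"
proof -
  interpret prob_space M by fact
  define F where "F = nat_filt M X"
  define S where "S t w = (\<Sum>i=1..t. l i w *\<^sub>R (X i w - \<mu>))" for t w
  define C where "C t w = (\<Sum>i=1..t. \<psi> (l i w) * op_norm (V i w))" for t w
  have X_M: "X s \<in> borel_measurable M" if "1 \<le> s" for s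
    using assms(4) that by (auto simp: has_const_cond_mean_def)
  have sub: "subalgebra M (F s)" for s
    unfolding F_def using X_M by (rule subalgebra_nat_filt)
  have mono: "sets (F s) \<subseteq> sets (F t)" if "s \<le> t" for s t
    unfolding F_def using that by (rule sets_nat_filt_mono)
  have space_F: "space (F s) = space M" for s
    by (simp add: F_def space_nat_filt)
  have lift: "f \<in> borel_measurable (F t)" if "f \<in> borel_measurable (F s)" "s \<le> t"
    for s t and f :: "'w \<Rightarrow> 'b::topological_space"
    using measurable_mono[of borel borel "F s" "F t"] mono[OF that(2)] that(1) by (auto simp: space_F)
  have l_range: "0 < l i w \<and> ereal (l i w) < lmax" if "1 \<le> i" "w \<in> space M" for i w
    using assms(7) that by blast
  have l_pred: "l i \<in> borel_measurable (F (i - 1))" if "1 \<le> i" for i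
    using assms(6) that by (simp add: predictable_def F_def)
  have l_F [measurable]: "l i \<in> borel_measurable (F t)" if "i \<in> {1..t}" for i t
    using that by (intro lift[OF l_pred]) auto
  have [measurable]: "(\<lambda>w. \<psi> (l i w)) \<in> borel_measurable (F t)" if "i \<in> {1..t}" for i t
    using super_gaussian_measurable[OF assms(3) l_F[OF that]] l_range that by (auto simp: space_F)
  have [measurable]: "X i \<in> borel_measurable (F t)" if "i \<in> {1..t}" for i t
    unfolding F_def using that by (rule measurable_nat_filt)
  have [measurable]: "V i \<in> borel_measurable (F t)" if "i \<in> {1..t}" for i t
  proof (rule lift)
    show "V i \<in> borel_measurable (F i)"
      unfolding F_def using that by (intro sub_psiD(1)[OF assms(5)]) simp
  qed (use that in auto)
  have S_F: "S t \<in> borel_measurable (F t)" for t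
    unfolding S_def[abs_def] by measurable
  have C_F: "C t \<in> borel_measurable (F t)" for t
    unfolding C_def[abs_def] by measurable
  have [measurable]: "S t \<in> borel_measurable M" "C t \<in> borel_measurable M" for t
    using measurable_from_subalg[OF sub S_F] measurable_from_subalg[OF sub C_F] by auto
  define bad where "bad = {w \<in> space M. \<exists>t. C t w + real CARD('n) * ln (1 / \<epsilon>) + ln (1 / \<alpha>)
    < (1 - \<epsilon>) * norm (S t w)}"
  have "bad \<in> sets M"
    unfolding bad_def by measurable
  have "emeasure M {w \<in> space M. \<exists>t. C t w + real DIM(real ^ 'n) * ln (1 / \<epsilon>) + ln (1 / \<alpha>)
    < (1 - \<epsilon>) * norm (S t w)} \<le> ennreal \<alpha>"
  proof (rule mixture_bound[where F = F, OF assms(1) sub mono S_F C_F])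
    show "(\<integral>\<^sup>+w. Z w * ennreal (exp (u \<bullet> S (Suc t) w - C (Suc t) w)) \<partial>M)
        \<le> (\<integral>\<^sup>+w. Z w * ennreal (exp (u \<bullet> S t w - C t w)) \<partial>M)"
      if u: "norm u \<le> 1" and Z: "Z \<in> borel_measurable (F t)" for t u Z
    proof -
      \<comment> \<open>The increment at \<open>Suc t\<close> splits off as a factor. The rest is
        \<open>F t\<close>-measurable and is absorbed into the test weight of
        \<open>sub_psi_step\<close>, whose index \<open>t - 1\<close> becomes
        \<open>Suc t - 1 = t\<close>.\<close>
      have "(\<integral>\<^sup>+w. Z w * ennreal (exp (u \<bullet> S (Suc t) w - C (Suc t) w)) \<partial>M)
          = (\<integral>\<^sup>+w. (Z w * ennreal (exp (u \<bullet> S t w - C t w)))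
              * ennreal (exp (u \<bullet> (l (Suc t) w *\<^sub>R (X (Suc t) w - \<mu>)) - \<psi> (l (Suc t) w) * op_norm (V (Suc t) w))) \<partial>M)"
        by (intro nn_integral_cong)
          (simp add: S_def C_def inner_add_right mult.assoc diff_diff_eq algebra_simps
            flip: ennreal_mult exp_add)
      also have "\<dots> \<le> (\<integral>\<^sup>+w. Z w * ennreal (exp (u \<bullet> S t w - C t w)) \<partial>M)"
        using u Z S_F[of t] C_F[of t] l_pred[of "Suc t"] l_range[of "Suc t"]
        by (intro sub_psi_step[OF assms(1,3,4,5)]) (auto simp: F_def)
      finally show ?thesis .
    qed
  qed (use assms in \<open>auto simp: S_def C_def\<close>)
  then have "prob bad \<le> \<alpha>"
    using \<open>0 < \<alpha>\<close> by (simp add: bad_def emeasure_eq_measure)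
  then have "1 - \<alpha> \<le> prob (space M - bad)"
    using \<open>bad \<in> sets M\<close> by (simp add: prob_compl)
  also have "space M - bad = {w \<in> space M. \<forall>t\<ge>1.
            norm ((\<Sum>i=1..t. l i w *\<^sub>R X i w) /\<^sub>R (\<Sum>i=1..t. l i w) - \<mu>)
            \<le> ((\<Sum>i=1..t. \<psi> (l i w) * op_norm (V i w))
                 + real CARD('n) * ln (1 / \<epsilon>) + ln (1 / \<alpha>))
              / ((1 - \<epsilon>) * (\<Sum>i=1..t. l i w))}"
  proof -
    \<comment> \<open>On a fixed path the claim and the condition defining the complement of
      \<open>bad\<close> differ only by the positive factors \<open>1 - \<epsilon>\<close> and the
      total weight.\<close>
    have bound_iff: "norm ((\<Sum>i=1..t. l i w *\<^sub>R X i w) /\<^sub>R (\<Sum>i=1..t. l i w) - \<mu>)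
        \<le> (C t w + real CARD('n) * ln (1 / \<epsilon>) + ln (1 / \<alpha>)) / ((1 - \<epsilon>) * (\<Sum>i=1..t. l i w))
      \<longleftrightarrow> (1 - \<epsilon>) * norm (S t w) \<le> C t w + real CARD('n) * ln (1 / \<epsilon>) + ln (1 / \<alpha>)"
      if "w \<in> space M" "1 \<le> t" for w t
    proof -
      define \<Lambda> where "\<Lambda> = (\<Sum>i=1..t. l i w)"
      have \<Lambda>: "0 < \<Lambda>"
        unfolding \<Lambda>_def using that l_range by (intro sum_pos) auto
      have "S t w = (\<Sum>i=1..t. l i w *\<^sub>R X i w) - \<Lambda> *\<^sub>R \<mu>"
        by (simp add: S_def \<Lambda>_def scaleR_diff_right sum_subtractf scaleR_left.sum)
      then have "(\<Sum>i=1..t. l i w *\<^sub>R X i w) /\<^sub>R \<Lambda> - \<mu> = S t w /\<^sub>R \<Lambda>"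
        using \<Lambda> by (simp add: scaleR_diff_right)
      then have norm_eq: "norm ((\<Sum>i=1..t. l i w *\<^sub>R X i w) /\<^sub>R \<Lambda> - \<mu>) = norm (S t w) / \<Lambda>"
        using \<Lambda> by (simp add: divide_inverse mult.commute)
      have "a / \<Lambda> \<le> b / ((1 - \<epsilon>) * \<Lambda>) \<longleftrightarrow> (1 - \<epsilon>) * a \<le> b" for a b
      proof -
        have "a / \<Lambda> \<le> b / ((1 - \<epsilon>) * \<Lambda>) \<longleftrightarrow> a / \<Lambda> \<le> b / (1 - \<epsilon>) / \<Lambda>"
          by simp
        also have "\<dots> \<longleftrightarrow> a \<le> b / (1 - \<epsilon>)"
          using \<Lambda> by (subst divide_le_cancel) auto
        also have "\<dots> \<longleftrightarrow> (1 - \<epsilon>) * a \<le> b"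
          using \<open>\<epsilon> < 1\<close> by (subst pos_le_divide_eq) (auto simp: mult.commute)
        finally show ?thesis .
      qed
      then show ?thesis
        unfolding \<Lambda>_def[symmetric] norm_eq .
    qed
    \<comment> \<open>\<open>bad\<close> includes time 0, which the claim leaves out. There
      \<open>S\<close> and \<open>C\<close> vanish, and the logarithmic terms are nonnegative
      because \<open>\<epsilon>\<close> and \<open>\<alpha>\<close> are below 1.\<close>
    have "0 \<le> real CARD('n) * ln (1 / \<epsilon>) + ln (1 / \<alpha>)"
      using assms by (intro add_nonneg_nonneg mult_nonneg_nonneg ln_ge_zero) auto
    then have time_zero: "(1 - \<epsilon>) * norm (S 0 w) \<le> C 0 w + real CARD('n) * ln (1 / \<epsilon>) + ln (1 / \<alpha>)" for w
      by (simp add: S_def C_def)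
    have "w \<notin> bad \<longleftrightarrow> (\<forall>t\<ge>1. norm ((\<Sum>i=1..t. l i w *\<^sub>R X i w) /\<^sub>R (\<Sum>i=1..t. l i w) - \<mu>)
        \<le> (C t w + real CARD('n) * ln (1 / \<epsilon>) + ln (1 / \<alpha>)) / ((1 - \<epsilon>) * (\<Sum>i=1..t. l i w)))"
      if w: "w \<in> space M" for w
    proof -
      have "w \<notin> bad \<longleftrightarrow>
          (\<forall>t. (1 - \<epsilon>) * norm (S t w) \<le> C t w + real CARD('n) * ln (1 / \<epsilon>) + ln (1 / \<alpha>))"
        using w by (auto simp: bad_def not_less)
      also have "\<dots> \<longleftrightarrow>
          (\<forall>t\<ge>1. (1 - \<epsilon>) * norm (S t w) \<le> C t w + real CARD('n) * ln (1 / \<epsilon>) + ln (1 / \<alpha>))"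
        using time_zero[of w] by (metis less_one not_less)
      finally show ?thesis
        using bound_iff[OF w] by simp
    qed
    then show ?thesis
      unfolding C_def by blast
  qed
  finally show ?thesis .
qed

end
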